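(* For every integer $m\ge 1$ there exists a tile counting function $f\in\mathcal{F}$ such that $f(n)\equiv C_n \pmod m$ for all $n\in\mathbb{N}$, where $C_n=\frac{1}{n+1}\binom{2n}{n}$ is the $n$-th Catalan number.
   Context: $\mathbb{N}=\{0,1,2,\ldots\}$. Tile counting functions: A tile is an axis-parallel simply connected closed polygon in $\mathbb{R}^2$ (side lengths may be irrational); tiles are considered up to translation. A tile is tall if it has height exactly $1$. For real $a\ge 0$ let $R_a=[1\times a]$ be the rectangle of height $1$ and length $a$. A tiling of $R_a$ with a finite set of tiles $T$ is a collection of translates of tiles of $T$ (no rotations or reflections) with pairwise disjoint interiors whose union is $R_a$ (for $a=0$ the only tiling is the empty one). For a finite set $T$ of tall tiles and a fixed real $\varepsilon\ge 0$, let $f_{T,\varepsilon}(n)$ be the number of tilings of $R_{n+\varepsilon}$ with $T$, $n\in\mathbb{N}$. $\mathcal{F}$ denotes the set of all functions $f_{T,\varepsilon}:\mathbb{N}\to\mathbb{N}$ obtained in this way. *)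

theory Defs
  imports "HOL-Analysis.Analysis" "HOL-Number_Theory.Cong"
begin

fun polygonal_path :: "(real \<times> real) list \<Rightarrow> real \<Rightarrow> real \<times> real" where
  "polygonal_path [] = linepath 0 0"
| "polygonal_path [a] = linepath a a"
| "polygonal_path [a, b] = linepath a b"
| "polygonal_path (a # b # c # ps) = linepath a b +++ polygonal_path (b # c # ps)"

definition axis_parallel :: "(real \<times> real) list \<Rightarrow> bool" where
  "axis_parallel ps \<longleftrightarrow> successively (\<lambda>p q. fst p = fst q \<or> snd p = snd q) ps"

text \<open>
  A polygon is the closed region bounded by a simple closed polygonal curve; the vertex list
  repeats its first vertex at the end. Simple connectedness is classically automatic for such
  a region (Schoenflies) and is recorded because it is part of the notion of a tile.
  Tiles are plane sets here; identifying translates is harmless because \<open>tilings\<close> below only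
  depends on the translation classes of the members of \<open>T\<close>.
\<close>
definition tile :: "(real \<times> real) set \<Rightarrow> bool" where
  "tile S \<longleftrightarrow> simply_connected S \<and>
     (\<exists>ps. axis_parallel ps \<and>
           simple_path (polygonal_path ps) \<and>
           pathfinish (polygonal_path ps) = pathstart (polygonal_path ps) \<and>
           S = path_image (polygonal_path ps) \<union> inside (path_image (polygonal_path ps)))"

definition height :: "(real \<times> real) set \<Rightarrow> real" where
  "height S = Sup (snd ` S) - Inf (snd ` S)"

definition tall_tile :: "(real \<times> real) set \<Rightarrow> bool" where
  "tall_tile S \<longleftrightarrow> tile S \<and> height S = 1"

definition rectangle :: "real \<Rightarrow> (real \<times> real) set" where
  "rectangle a = {0..a} \<times> {0..1}"

text \<open>
  A tiling is the set of its placed tiles. Since tiles have nonempty interior, no placed tile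
  can occur twice, so sets suffice. The case \<open>a = 0\<close> is separate because \<open>rectangle 0\<close> is a
  segment rather than the empty set, but is to have exactly one tiling, the empty one.
\<close>
definition tilings :: "(real \<times> real) set set \<Rightarrow> real \<Rightarrow> (real \<times> real) set set set" where
  "tilings T a =
     (if a = 0 then {{}}
      else {P. (\<forall>S\<in>P. \<exists>t\<in>T. \<exists>v. S = (\<lambda>x. v + x) ` t) \<and>
               pairwise (\<lambda>S S'. interior S \<inter> interior S' = {}) P \<and>
               \<Union>P = rectangle a})"

text \<open>For a finite set \<open>T\<close> of tall tiles there are only finitely many tilings, so \<open>card\<close> counts them.\<close>
definition tile_count :: "(real \<times> real) set set \<Rightarrow> real \<Rightarrow> nat \<Rightarrow> nat" where
  "tile_count T \<epsilon> n = card (tilings T (real n + \<epsilon>))"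

definition tile_counting_functions :: "(nat \<Rightarrow> nat) set" where
  "tile_counting_functions =
     {tile_count T \<epsilon> | T \<epsilon>. finite T \<and> (\<forall>t\<in>T. tall_tile t) \<and> 0 \<le> \<epsilon>}"

definition catalan :: "nat \<Rightarrow> nat" where
  "catalan n = ((2 * n) choose n) div (n + 1)"

text \<open>The division in \<open>catalan\<close> is exact.\<close>
lemma catalan_exact: "(n + 1) * catalan n = (2 * n) choose n"
proof -
  have "Suc n * ((2 * n) choose Suc n) = n * ((2 * n) choose n)"
    using binomial_absorb_comp[of "2 * n" n] binomial_absorption[of n "2 * n"]
    by (simp only: mult_2 add_diff_cancel_left')
  hence "(n + 1) * (((2 * n) choose n) - ((2 * n) choose Suc n)) = (2 * n) choose n"
    by (simp add: diff_mult_distrib2)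
  hence "(n + 1) dvd ((2 * n) choose n)"
    by (metis dvd_triv_left)
  thus ?thesis
    unfolding catalan_def by (rule dvd_mult_div_cancel)
qed

end

(*
  Only rectangles of length log 6 k with k a natural number are used. Tilings of a rectangle of
  length log 6 N are then ordered factorizations of N, and lengthening it by 1 multiplies N by 6,
  so unique factorization takes the place of irrationality arguments.

  The letters 2 and 3 are ordinary; a few letters are special. The numbers
  x_0 = (2n+1)! / n!^2 and x_1 = (2n+1)! / ((n+1)! (n-1)!) count words with one special letter,
  g_0 = (2n)! / (n-1)!^2 and g_1 = (2n)! / (n! (n-2)!) count words with two, and
  x_0 + x_1 - 4 g_0 + 4 g_1 = C_n. A pair of special letters may be chosen in any number of ways
  with the same product, so g_0 and g_1 can be given any multiplicities: 4m - 4 and 4.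
*)
theory Submission
  imports Defs "HOL-Combinatorics.Multiset_Permutations"
begin

subsection \<open>Rectangles as tiles\<close>

lemma frontier_rectangle:
  assumes "0 < w"
  shows "frontier (rectangle w) =
    {0..w} \<times> {0} \<union> ({w} \<times> {0..1} \<union> ({0..w} \<times> {1} \<union> {0} \<times> {0..1}))"
  using assms
  by (auto simp: rectangle_def frontier_def closure_Times interior_Times)

text \<open>The closed curve through the four corners is the frontier, and the inside of the
  frontier of a bounded convex set is its interior. Curve and inside together give back the closed
  rectangle.\<close>

lemma tall_tile_rectangle:
  assumes "0 < w"
  shows "tall_tile (rectangle w)"
proof -
  let ?ps = "[(0, 0), (w, 0), (w, 1), (0, 1), (0, 0)] :: (real \<times> real) list"
  have conv: "convex (rectangle w)" and bdd: "bounded (rectangle w)"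
    by (auto simp: rectangle_def intro!: convex_Times bounded_Times)
  have image: "path_image (polygonal_path ?ps) = frontier (rectangle w)"
    using assms unfolding frontier_rectangle[OF assms]
    by (simp add: path_image_join closed_segment_same_fst closed_segment_same_snd
        closed_segment_eq_real_ivl)
  have "simple_path (polygonal_path ?ps)"
    using assms unfolding polygonal_path.simps
    by (intro simple_path_join_loop arc_join arc_linepath)
       (auto simp: path_image_join closed_segment_same_fst closed_segment_same_snd
         closed_segment_eq_real_ivl)
  moreover have "rectangle w = frontier (rectangle w) \<union> interior (rectangle w)"
    by (auto simp: frontier_def rectangle_def closure_Times interior_Times)
  moreover have "axis_parallel ?ps"
    by (simp add: axis_parallel_def)
  ultimately have "tile (rectangle w)"
    unfolding tile_def using image inside_frontier_eq_interior[OF bdd conv]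
    by (intro conjI exI[of _ ?ps] convex_imp_simply_connected conv) auto
  moreover have "height (rectangle w) = 1"
    using assms by (auto simp: height_def rectangle_def)
  ultimately show ?thesis
    by (simp add: tall_tile_def)
qed

subsection \<open>Tilings by rectangles as words\<close>

definition strip :: "real \<Rightarrow> real \<Rightarrow> (real \<times> real) set" where
  "strip u w = {u..u + w} \<times> {0..1}"

fun place :: "real \<Rightarrow> real list \<Rightarrow> (real \<times> real) set set" where
  "place c [] = {}"
| "place c (w # ws) = insert (strip c w) (place (c + w) ws)"

lemma strip_eq_iff:
  assumes "0 < w" "0 < w'"
  shows "strip u w = strip u' w' \<longleftrightarrow> u = u' \<and> w = w'"
  using assms by (auto simp: strip_def times_eq_iff Icc_eq_Icc)

lemma interior_strip: "interior (strip u w) = {u<..<u + w} \<times> {0<..<1}"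
  by (simp add: strip_def interior_Times)

lemma interior_strip_disjoint_iff:
  assumes "0 < w" "0 < w'"
  shows "interior (strip u w) \<inter> interior (strip u' w') = {} \<longleftrightarrow> u + w \<le> u' \<or> u' + w' \<le> u"
proof
  assume disj: "interior (strip u w) \<inter> interior (strip u' w') = {}"
  show "u + w \<le> u' \<or> u' + w' \<le> u"
  proof (rule ccontr)
    assume "\<not> (u + w \<le> u' \<or> u' + w' \<le> u)"
    then have "max u u' < min (u + w) (u' + w')"
      using assms by auto
    then obtain x where "max u u' < x" "x < min (u + w) (u' + w')"
      using dense by blast
    then have "(x, 1/2) \<in> interior (strip u w) \<inter> interior (strip u' w')"
      by (auto simp: interior_strip)
    with disj show False
      by blast
  qed
qed (auto simp: interior_strip)

lemma place_strip:
  assumes "\<forall>w\<in>set ws. 0 < w" "S \<in> place c ws"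
  obtains u w where "S = strip u w" "w \<in> set ws" "c \<le> u" "u + w \<le> c + sum_list ws"
  using assms
proof (induction ws arbitrary: c thesis)
  case (Cons v ws)
  have nonneg: "0 \<le> sum_list ws"
    using Cons.prems(2) by (intro sum_list_nonneg) auto
  show ?case
  proof (cases "S = strip c v")
    case True
    then show ?thesis
      using Cons.prems(1)[of c v] nonneg by auto
  next
    case False
    then have "S \<in> place (c + v) ws"
      using Cons.prems(3) by simp
    then obtain u w where "S = strip u w" "w \<in> set ws" "c + v \<le> u" "u + w \<le> c + v + sum_list ws"
      using Cons.IH[of "c + v"] Cons.prems(2) by auto
    moreover have "0 < v"
      using Cons.prems(2) by simp
    ultimately show ?thesis
      using Cons.prems(1)[of u w] by auto
  qed
qed simp

text \<open>All later strips start at \<open>c + v\<close> or beyond, and a strip of positive width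
  determines its left end. Hence the insertion in \<open>place\<close> always adds a new strip and
  can be undone.\<close>

lemma strip_notin_place:
  assumes "\<forall>w\<in>set ws. 0 < w" "0 < v"
  shows "strip c v \<notin> place (c + v) ws"
proof
  assume "strip c v \<in> place (c + v) ws"
  then obtain u w where "strip c v = strip u w" "w \<in> set ws" "c + v \<le> u"
    using place_strip[OF assms(1)] by metis
  then show False
    using assms strip_eq_iff[of v w c u] by auto
qed

text \<open>The first letter is the width of the only strip starting at \<open>c\<close>; removing
  that strip leaves the placement of the remaining word.\<close>

lemma place_inject:
  assumes "\<forall>w\<in>set ws. 0 < w" "\<forall>w\<in>set ws'. 0 < w" "place c ws = place c ws'"
  shows "ws = ws'"
  using assms
proof (induction ws arbitrary: c ws')
  case Nil
  then show ?case
    by (cases ws') auto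
next
  case (Cons v ws)
  then obtain v' vs where ws': "ws' = v' # vs"
    by (cases ws') auto
  have pos: "0 < v" "0 < v'" "\<forall>w\<in>set ws. 0 < w" "\<forall>w\<in>set vs. 0 < w"
    using Cons.prems ws' by auto
  \<comment> \<open>All strips after the first one in the second word start to the right of
    \<open>c\<close>, so \<open>strip c v\<close> can only be its first strip.\<close>
  have "strip c v \<notin> place (c + v') vs"
  proof
    assume "strip c v \<in> place (c + v') vs"
    then obtain u w where "strip c v = strip u w" "w \<in> set vs" "c + v' \<le> u"
      using place_strip[OF pos(4)] by metis
    then show False
      using pos strip_eq_iff[of v w c u] by auto
  qed
  then have "strip c v = strip c v'"
    using Cons.prems(3) ws' by auto
  then have v: "v = v'"
    using strip_eq_iff[OF pos(1,2)] by simp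
  have "place (c + v) ws = place (c + v) vs"
    using Cons.prems(3) ws' v strip_notin_place[OF pos(3,1)] strip_notin_place[OF pos(4,1)]
    by (metis insert_ident place.simps(2))
  then show ?case
    using Cons.IH pos ws' v by blast
qed

text \<open>The empty word is excluded because \<open>strip c 0\<close> is a segment, while the
  union of no strips is empty.\<close>

lemma Union_place:
  assumes "\<forall>w\<in>set ws. 0 < w" "ws \<noteq> []"
  shows "\<Union>(place c ws) = strip c (sum_list ws)"
  using assms
proof (induction ws arbitrary: c)
  case (Cons v ws)
  show ?case
  proof (cases "ws = []")
    case False
    have "0 \<le> sum_list ws"
      using Cons.prems by (intro sum_list_nonneg) auto
    then show ?thesis
      using Cons False by (auto simp: strip_def add.assoc)
  qed simp
qed simp

lemma pairwise_place:
  assumes "\<forall>w\<in>set ws. 0 < w"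
  shows "pairwise (\<lambda>S S'. interior S \<inter> interior S' = {}) (place c ws)"
  using assms
proof (induction ws arbitrary: c)
  case (Cons v ws)
  have pos: "0 < v" "\<forall>w\<in>set ws. 0 < w"
    using Cons.prems by auto
  have "interior (strip c v) \<inter> interior S = {}" if S: "S \<in> place (c + v) ws" for S
  proof -
    obtain u w where "S = strip u w" "w \<in> set ws" "c + v \<le> u"
      using place_strip[OF pos(2) S] by metis
    then show ?thesis
      using interior_strip_disjoint_iff[of v w c u] pos by simp
  qed
  with Cons.IH[OF pos(2)] show ?case
    by (simp add: pairwise_insert Int_commute)
qed simp

section \<open>Reading the word off a tiling from left to right\<close>

text \<open>
  Covering only the open interval makes the predicate stable under removal of the leftmost strip
  and leaves just the empty family when \<open>c = a\<close>.
\<close>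
definition strip_tiling :: "real set \<Rightarrow> real \<Rightarrow> real \<Rightarrow> (real \<times> real) set set \<Rightarrow> bool" where
  "strip_tiling W c a P \<longleftrightarrow>
     (\<forall>S\<in>P. \<exists>u. \<exists>w\<in>W. S = strip u w \<and> c \<le> u \<and> u + w \<le> a) \<and>
     pairwise (\<lambda>S S'. interior S \<inter> interior S' = {}) P \<and>
     {c<..<a} \<times> {0..1} \<subseteq> \<Union>P"

text \<open>A covered point close to \<open>c\<close> gives a strip starting at some
  \<open>u\<close>. If \<open>u > c\<close>, the strip covering the midpoint of \<open>c\<close> and
  \<open>u\<close> starts before \<open>u\<close> and is wide enough to overlap the first one. The
  bound \<delta> keeps strips from accumulating at \<open>c\<close>, as \<open>P\<close> is not
  known to be finite.\<close>

lemma strip_tiling_first: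
  assumes tiling: "strip_tiling W c a P" and "c < a" "0 < \<delta>" and min: "\<forall>w\<in>W. \<delta> \<le> w"
  obtains w where "w \<in> W" "strip c w \<in> P"
proof -
  have cover: "\<exists>u. \<exists>w\<in>W. strip u w \<in> P \<and> c \<le> u \<and> u \<le> t" if "c < t" "t < a" for t
  proof -
    have "(t, 0) \<in> {c<..<a} \<times> {0..1::real}"
      using that by simp
    then have "(t, 0) \<in> \<Union>P"
      using tiling unfolding strip_tiling_def by blast
    then obtain S where S: "S \<in> P" "(t, 0) \<in> S"
      by auto
    then obtain u w where "S = strip u w" "w \<in> W" "c \<le> u"
      using tiling unfolding strip_tiling_def by blast
    with S show ?thesis
      by (auto simp: strip_def intro!: exI[of _ u] bexI[of _ w])
  qed
  \<comment> \<open>Below \<open>c + \<delta>\<close>, so that every strip starting in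
    \<open>[c, t]\<close> reaches beyond \<open>t\<close>; below \<open>a\<close>, so that the point
    is covered.\<close>
  define t where "t = min (c + \<delta> / 2) ((c + a) / 2)"
  have t: "c < t" "t < a" "t < c + \<delta>"
    using assms by (auto simp: t_def min_def)
  obtain u w where u: "w \<in> W" "strip u w \<in> P" "c \<le> u" "u \<le> t"
    using cover[OF t(1,2)] by blast
  have "u = c"
  proof (rule ccontr)
    assume "u \<noteq> c"
    then have "c < u" "(c + u) / 2 < a"
      using u t by auto
    then obtain u' w' where u': "w' \<in> W" "strip u' w' \<in> P" "c \<le> u'" "u' \<le> (c + u) / 2"
      using cover[of "(c + u) / 2"] by auto
    have pos: "0 < w" "0 < w'" "\<delta> \<le> w'" "\<delta> \<le> w"
      using u u' min \<open>0 < \<delta>\<close> by force+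
    have "u' < u"
      using u' \<open>c < u\<close> by simp
    then have "strip u w \<noteq> strip u' w'"
      using strip_eq_iff[OF pos(1,2)] by simp
    then have "interior (strip u w) \<inter> interior (strip u' w') = {}"
      using tiling u(2) u'(2) unfolding strip_tiling_def by (meson pairwiseD)
    then show False
      using interior_strip_disjoint_iff[OF pos(1,2)] u u' t pos \<open>u' < u\<close> by auto
  qed
  then show thesis
    using that u by blast
qed

lemma strip_tiling_place:
  assumes "strip_tiling W c a P" "c \<le> a" "0 < \<delta>" "\<forall>w\<in>W. \<delta> \<le> w"
  shows "\<exists>ws. set ws \<subseteq> W \<and> sum_list ws = a - c \<and> P = place c ws"
proof -
  \<comment> \<open>Each strip is at least \<delta> wide, so \<open>k\<close> bounds the number of
    strips still to come; it serves as induction measure.\<close>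
  obtain k :: nat where "a - c < k * \<delta>"
    using reals_Archimedean3[OF \<open>0 < \<delta>\<close>] by blast
  then show ?thesis
    using assms(1,2)
  proof (induction k arbitrary: c P)
    case (Suc k)
    have pos: "0 < w" if "w \<in> W" for w
      using assms(3,4) that by force
    show ?case
    proof (cases "c = a")
      case True
      have "P = {}"
      proof (rule ccontr)
        assume "P \<noteq> {}"
        then obtain u w where "w \<in> W" "c \<le> u" "u + w \<le> a"
          using Suc.prems(2) unfolding strip_tiling_def by blast
        then show False
          using pos[of w] True by simp
      qed
      then show ?thesis
        using True by (auto intro!: exI[of _ "[]"])
    next
      case False
      then have "c < a"
        using Suc.prems by simp
      then obtain w where w: "w \<in> W" "strip c w \<in> P"
        using strip_tiling_first Suc.prems(2) assms(3,4) by metis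
      obtain u' w' where "strip c w = strip u' w'" "w' \<in> W" "u' + w' \<le> a"
        using Suc.prems(2) w(2) unfolding strip_tiling_def by blast
      then have le: "c + w \<le> a"
        using strip_eq_iff[OF pos pos] w(1) by auto
      have "strip_tiling W (c + w) a (P - {strip c w})"
        unfolding strip_tiling_def
      proof (intro conjI ballI)
        fix S assume S: "S \<in> P - {strip c w}"
        then obtain u v where uv: "S = strip u v" "v \<in> W" "c \<le> u" "u + v \<le> a"
          using Suc.prems(2) unfolding strip_tiling_def by blast
        have "interior (strip c w) \<inter> interior (strip u v) = {}"
          using Suc.prems(2) w(2) S uv(1) unfolding strip_tiling_def pairwise_def by blast
        \<comment> \<open>The other alternative, \<open>u + v \<le> c\<close>, contradicts
          \<open>c \<le> u\<close> and \<open>0 < v\<close>.\<close>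
        then have "c + w \<le> u"
          using interior_strip_disjoint_iff[OF pos pos, OF w(1) uv(2)] uv pos[of v] by auto
        with uv show "\<exists>u. \<exists>v\<in>W. S = strip u v \<and> c + w \<le> u \<and> u + v \<le> a"
          by blast
      next
        show "pairwise (\<lambda>S S'. interior S \<inter> interior S' = {}) (P - {strip c w})"
          using Suc.prems(2) unfolding strip_tiling_def by (auto simp: pairwise_def)
      next
        show "{c + w<..<a} \<times> {0..1} \<subseteq> \<Union>(P - {strip c w})"
        proof
          fix z assume z: "z \<in> {c + w<..<a} \<times> {0..1::real}"
          then have "z \<in> {c<..<a} \<times> {0..1}" "z \<notin> strip c w"
            using pos[OF w(1)] by (auto simp: strip_def)
          then show "z \<in> \<Union>(P - {strip c w})"
            using Suc.prems(2) unfolding strip_tiling_def by blast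
        qed
      qed
      moreover have "a - (c + w) < k * \<delta>"
        using Suc.prems(1) w(1) assms(4) by (auto simp: algebra_simps)
      ultimately obtain ws where
        "set ws \<subseteq> W" "sum_list ws = a - (c + w)" "P - {strip c w} = place (c + w) ws"
        using Suc.IH le by blast
      then show ?thesis
        using w by (intro exI[of _ "w # ws"]) (auto simp del: insert_Diff_single)
    qed
  qed simp
qed

lemma translate_rectangle: "(+) (u, v) ` rectangle w = {u..u + w} \<times> {v..v + 1}"
proof -
  have "{u..u + w} \<times> {v..v + 1} \<subseteq> (+) (u, v) ` rectangle w"
  proof
    fix z assume "z \<in> {u..u + w} \<times> {v..v + 1}"
    then show "z \<in> (+) (u, v) ` rectangle w"
      by (intro image_eqI[of _ _ "z - (u, v)"]) (auto simp: rectangle_def)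
  qed
  then show ?thesis
    by (auto simp: rectangle_def)
qed

lemma tilings_rectangles:
  assumes "finite W" "\<forall>w\<in>W. 0 < w" "0 < a"
  shows "tilings (rectangle ` W) a = place 0 ` {ws. set ws \<subseteq> W \<and> sum_list ws = a}"
proof (intro equalityI subsetI)
  fix P assume P: "P \<in> tilings (rectangle ` W) a"
  then have tiles: "\<forall>S\<in>P. \<exists>t\<in>rectangle ` W. \<exists>v. S = (+) v ` t"
    and disj: "pairwise (\<lambda>S S'. interior S \<inter> interior S' = {}) P"
    and union: "\<Union>P = rectangle a"
    using assms(3) by (auto simp: tilings_def)
  have "strip_tiling W 0 a P"
    unfolding strip_tiling_def
  proof (intro conjI ballI disj)
    fix S assume S: "S \<in> P"
    then obtain w u v where w: "w \<in> W" and S_eq: "S = {u..u + w} \<times> {v..v + 1}"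
      using tiles translate_rectangle by fastforce
    have "0 < w"
      using w assms(2) by simp
    have "S \<subseteq> {0..a} \<times> {0..1}"
      using S union by (auto simp: rectangle_def)
    \<comment> \<open>Two opposite corners suffice: tile and rectangle both have height 1, so there
      is no room to shift vertically and \<open>v = 0\<close>.\<close>
    moreover have "(u, v) \<in> S" "(u + w, v + 1) \<in> S"
      using \<open>0 < w\<close> by (auto simp: S_eq)
    ultimately have "(u, v) \<in> {0..a} \<times> {0..1}" "(u + w, v + 1) \<in> {0..a} \<times> {0..1}"
      by blast+
    then have "0 \<le> u" "u + w \<le> a" "v = 0"
      by auto
    then show "\<exists>u. \<exists>w\<in>W. S = strip u w \<and> 0 \<le> u \<and> u + w \<le> a"
      using w S_eq by (auto simp: strip_def)
  next
    show "{0<..<a} \<times> {0..1} \<subseteq> \<Union>P"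
      unfolding union by (auto simp: rectangle_def)
  qed
  moreover obtain \<delta> where "0 < \<delta>" "\<forall>w\<in>W. \<delta> \<le> w"
  proof
    \<comment> \<open>Inserting 1 keeps the minimum meaningful when \<open>W\<close> is
      empty.\<close>
    show "0 < Min (insert 1 W)" "\<forall>w\<in>W. Min (insert 1 W) \<le> w"
      using assms(1,2) by auto
  qed
  ultimately show "P \<in> place 0 ` {ws. set ws \<subseteq> W \<and> sum_list ws = a}"
    using strip_tiling_place[of W 0 a P] assms(3) by fastforce
next
  fix P assume "P \<in> place 0 ` {ws. set ws \<subseteq> W \<and> sum_list ws = a}"
  then obtain ws where ws: "set ws \<subseteq> W" "sum_list ws = a" and P: "P = place 0 ws"
    by auto
  have pos: "\<forall>w\<in>set ws. 0 < w" and "ws \<noteq> []"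
    using ws assms by auto
  have "\<exists>t\<in>rectangle ` W. \<exists>v. S = (+) v ` t" if S: "S \<in> P" for S
  proof -
    obtain u w where "S = strip u w" "w \<in> set ws"
      using place_strip[OF pos S[unfolded P]] by metis
    then have "S = (+) (u, 0) ` rectangle w" "w \<in> W"
      using translate_rectangle[of u 0 w] ws by (auto simp: strip_def)
    then show ?thesis
      by blast
  qed
  then show "P \<in> tilings (rectangle ` W) a"
    using assms(3) Union_place[OF pos \<open>ws \<noteq> []\<close>, of 0] pairwise_place[OF pos, of 0] ws(2) P
    by (simp add: tilings_def strip_def rectangle_def)
qed

lemma card_tilings_rectangles:
  assumes "finite W" "\<forall>w\<in>W. 0 < w" "0 < a"
  shows "card (tilings (rectangle ` W) a) = card {ws. set ws \<subseteq> W \<and> sum_list ws = a}"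
  unfolding tilings_rectangles[OF assms]
proof (rule card_image)
  show "inj_on (place 0) {ws. set ws \<subseteq> W \<and> sum_list ws = a}"
    using assms(2) by (intro inj_onI place_inject[of _ _ 0]) auto
qed

section \<open>From logarithmic widths to ordered factorizations\<close>

definition factorizations :: "nat set \<Rightarrow> nat \<Rightarrow> nat list set" where
  "factorizations K N = {ks. set ks \<subseteq> K \<and> prod_list ks = N}"

lemma log_prod_list:
  assumes "1 < b" "\<forall>k\<in>set ks. 0 < k"
  shows "log b (real (prod_list ks)) = (\<Sum>k\<leftarrow>ks. log b (real k))"
  using assms
proof (induction ks)
  case (Cons k ks)
  then have "0 < prod_list ks"
    by (metis list.set_intros(2) not_gr_zero prod_list_zero_iff)
  with Cons show ?case
    by (simp add: log_mult)
qed simp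

text \<open>The logarithm turns products into sums and is injective on positive numbers, so distinct
  factors have distinct widths and a word of widths has the right total exactly when its factors
  have the right product. The bounds by 2 make all lengths positive.\<close>

lemma card_tilings_log:
  fixes K :: "nat set"
  assumes "finite K" "\<forall>k\<in>K. 2 \<le> k" "1 < b" "2 \<le> N"
  shows "card (tilings (rectangle ` (\<lambda>k. log b (real k)) ` K) (log b (real N))) =
    card (factorizations K N)"
proof -
  let ?L = "\<lambda>k. log b (real k)"
  have inj: "inj_on ?L {0<..}"
    using assms(3) by (auto simp: inj_on_def log_def)
  have K: "K \<subseteq> {0<..}"
    using assms(2) by force
  have log_eq: "sum_list (map ?L ks) = ?L N \<longleftrightarrow> prod_list ks = N" if "set ks \<subseteq> K" for ks
  proof -
    have pos: "\<forall>k\<in>set ks. 0 < k"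
      using that K by auto
    then have "0 < prod_list ks"
      by (metis not_gr_zero prod_list_zero_iff)
    then show ?thesis
      using inj_on_eq_iff[OF inj, of "prod_list ks" N] assms(4) log_prod_list[OF assms(3) pos]
      by simp
  qed
  have "{ws. set ws \<subseteq> ?L ` K \<and> sum_list ws = ?L N} = map ?L ` factorizations K N"
  proof (intro equalityI subsetI)
    fix ws assume ws: "ws \<in> {ws. set ws \<subseteq> ?L ` K \<and> sum_list ws = ?L N}"
    then have "ws \<in> lists (?L ` K)"
      by auto
    then obtain ks where "set ks \<subseteq> K" "ws = map ?L ks"
      by (auto simp: lists_image)
    then show "ws \<in> map ?L ` factorizations K N"
      using ws log_eq by (auto simp: factorizations_def)
  qed (use log_eq in \<open>auto simp: factorizations_def intro!: imageI\<close>)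
  moreover have "inj_on (map ?L) (factorizations K N)"
  proof (rule inj_on_subset)
    show "inj_on (map ?L) (lists K)"
      using inj K by (meson inj_on_subset inj_on_map_lists)
  qed (auto simp: factorizations_def)
  moreover have "\<forall>w\<in>?L ` K. 0 < w" "0 < ?L N"
    using assms by force+
  ultimately show ?thesis
    using card_tilings_rectangles[of "?L ` K" "?L N"] assms(1) by (simp add: card_image)
qed

subsection \<open>Words with prescribed letters\<close>

text \<open>Letters of \<open>X\<close> missing from \<open>A\<close> contribute
  \<open>0! = 1\<close>. The product can thus run over a fixed alphabet even when a letter occurs 0
  times.\<close>

lemma card_permutations_of_multiset_superset:
  assumes "finite X" "set_mset A \<subseteq> X"
  shows "card (permutations_of_multiset A) * (\<Prod>x\<in>X. fact (count A x)) = fact (size A)"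
proof -
  have "(\<Prod>x\<in>X. fact (count A x)) = (\<Prod>x\<in>set_mset A. fact (count A x) :: nat)"
    using assms by (intro prod.mono_neutral_right) (auto simp: not_in_iff)
  then show ?thesis
    using card_permutations_of_multiset_aux[of A] by simp
qed

lemma card_permutations_one_extra:
  assumes "distinct [x, y, s]"
  shows "card (permutations_of_multiset (replicate_mset a x + replicate_mset b y + {#s#})) *
    (fact a * fact b) = fact (a + b + 1)"
proof -
  let ?A = "replicate_mset a x + replicate_mset b y + {#s#}"
  have "set_mset ?A \<subseteq> {x, y, s}"
    by (auto split: if_splits)
  moreover have "distinct [s, y, x]"
    using assms by auto
  then have "(\<Prod>z\<in>{x, y, s}. fact (count ?A z)) = (fact a * fact b :: nat)"
    using assms by simp
  ultimately show ?thesis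
    using card_permutations_of_multiset_superset[of "{x, y, s}" ?A] by simp
qed

lemma card_permutations_two_extra:
  assumes "distinct [x, y, p, q]"
  shows "card (permutations_of_multiset (replicate_mset a x + replicate_mset b y + {#p, q#})) *
    (fact a * fact b) = fact (a + b + 2)"
proof -
  let ?A = "replicate_mset a x + replicate_mset b y + {#p, q#}"
  have "set_mset ?A \<subseteq> {x, y, p, q}"
    by (auto split: if_splits)
  moreover have "distinct [q, p, y, x]"
    using assms by auto
  then have "(\<Prod>z\<in>{x, y, p, q}. fact (count ?A z)) = (fact a * fact b :: nat)"
    using assms by simp
  ultimately show ?thesis
    using card_permutations_of_multiset_superset[of "{x, y, p, q}" ?A] by simp
qed

text \<open>Words are grouped by their multiset of letters, which already determines the product;
  different multisets have no arrangement in common.\<close>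

lemma card_factorizations:
  assumes "finite {A. set_mset A \<subseteq> K \<and> prod_mset A = N}"
  shows "card (factorizations K N) =
    (\<Sum>A | set_mset A \<subseteq> K \<and> prod_mset A = N. card (permutations_of_multiset A))"
proof -
  have "factorizations K N =
    (\<Union>A\<in>{A. set_mset A \<subseteq> K \<and> prod_mset A = N}. permutations_of_multiset A)"
    by (auto simp: factorizations_def permutations_of_multiset_def prod_mset_prod_list)
  moreover have "permutations_of_multiset A \<inter> permutations_of_multiset B = {}" if "A \<noteq> B"
    for A B :: "nat multiset"
    using that by (auto simp: permutations_of_multiset_def)
  ultimately show ?thesis
    using assms by (simp add: card_UN_disjoint)
qed

subsection \<open>A set of factors whose words count Catalan numbers\<close>

text \<open>
  A word with product \<open>2 ^ (n + 1) * 3 ^ n * 7 * 5 ^ (2 * M)\<close> contains exactly one multiple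
  of 7. Its power of 5 then leaves room for at most one factor \<open>5 ^ i\<close> with \<open>i > M\<close>, and that
  factor must be the matching one. The indices 0 and 1 stand for the words without such a factor.
\<close>
definition exp2 :: "nat \<Rightarrow> nat \<Rightarrow> nat" where
  "exp2 M i = (if i = 0 then 1 else if i = 1 then 0 else if i + 4 \<le> 2 * M then 2 else 1)"

definition exp3 :: "nat \<Rightarrow> nat \<Rightarrow> nat" where
  "exp3 M i = (if i = 0 then 0 else if i = 1 then 1 else if i + 4 \<le> 2 * M then 1 else 2)"

definition exp5 :: "nat \<Rightarrow> nat \<Rightarrow> nat" where
  "exp5 M i = (if i \<le> 1 then 2 * M else 2 * M - i)"

text \<open>The exponents of 2 and 3 fix how many ordinary letters remain beside the special ones:
  \<open>n\<close> and \<open>n\<close> for index 0, \<open>n + 1\<close> and \<open>n - 1\<close>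
  for index 1, \<open>n - 1\<close> and \<open>n - 1\<close> for pairs with
  \<open>i + 4 \<le> 2 * M\<close>, and \<open>n\<close> and \<open>n - 2\<close> for the other
  pairs. These choices yield \<open>x_0\<close>, \<open>x_1\<close>, \<open>g_0\<close> and
  \<open>g_1\<close>.\<close>

definition marker :: "nat \<Rightarrow> nat \<Rightarrow> nat" where
  "marker M i = 2 ^ exp2 M i * 3 ^ exp3 M i * 5 ^ exp5 M i * 7"

definition indices :: "nat \<Rightarrow> nat set" where
  "indices M = {0, 1} \<union> {M<..2 * M}"

definition factors :: "nat \<Rightarrow> nat set" where
  "factors M = {2, 3} \<union> (\<lambda>i. 5 ^ i) ` {M<..2 * M} \<union> marker M ` indices M"

definition target :: "nat \<Rightarrow> nat \<Rightarrow> nat" where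
  "target M n = 2 ^ (n + 1) * 3 ^ n * 5 ^ (2 * M) * 7"

definition special :: "nat \<Rightarrow> nat \<Rightarrow> nat multiset" where
  "special M i = (if i \<le> 1 then {#marker M i#} else {#5 ^ i, marker M i#})"

definition letters :: "nat \<Rightarrow> nat \<Rightarrow> nat \<Rightarrow> nat multiset" where
  "letters M n i =
     replicate_mset (n + 1 - exp2 M i) 2 + replicate_mset (n - exp3 M i) 3 + special M i"

section \<open>Exponents of 2, 3, 5 and 7 in the letters and in the target\<close>

lemma multiplicity_monomial:
  "multiplicity 2 (2 ^ a * 3 ^ b * 5 ^ c * 7 ^ d :: nat) = a"
  "multiplicity 3 (2 ^ a * 3 ^ b * 5 ^ c * 7 ^ d :: nat) = b"
  "multiplicity 5 (2 ^ a * 3 ^ b * 5 ^ c * 7 ^ d :: nat) = c"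
  "multiplicity 7 (2 ^ a * 3 ^ b * 5 ^ c * 7 ^ d :: nat) = d"
proof -
  have p: "prime (2::nat)" "prime (3::nat)" "prime (5::nat)" "prime (7::nat)"
    by simp_all
  have nd: "\<not> p dvd q" if "prime p" "prime q" "p \<noteq> q" for p q :: nat
    using that primes_dvd_imp_eq by blast
  have z: "multiplicity p q = 0" if "prime p" "prime q" "p \<noteq> q" for p q :: nat
    using that nd by (simp add: not_dvd_imp_multiplicity_0)
  note [simp] = prime_elem_multiplicity_mult_distrib prime_elem_multiplicity_power_distrib z
  show "multiplicity 2 (2 ^ a * 3 ^ b * 5 ^ c * 7 ^ d :: nat) = a"
    "multiplicity 3 (2 ^ a * 3 ^ b * 5 ^ c * 7 ^ d :: nat) = b"
    "multiplicity 5 (2 ^ a * 3 ^ b * 5 ^ c * 7 ^ d :: nat) = c"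
    "multiplicity 7 (2 ^ a * 3 ^ b * 5 ^ c * 7 ^ d :: nat) = d"
    by simp_all
qed

lemma multiplicity_marker:
  "multiplicity 2 (marker M i) = exp2 M i" "multiplicity 3 (marker M i) = exp3 M i"
  "multiplicity 5 (marker M i) = exp5 M i" "multiplicity 7 (marker M i) = 1"
  using multiplicity_monomial[of "exp2 M i" "exp3 M i" "exp5 M i" 1] by (simp_all add: marker_def)

lemma multiplicity_target:
  "multiplicity 2 (target M n) = n + 1" "multiplicity 3 (target M n) = n"
  "multiplicity 5 (target M n) = 2 * M" "multiplicity 7 (target M n) = 1"
  using multiplicity_monomial[of "n + 1" n "2 * M" 1] by (simp_all add: target_def)

lemma multiplicity_power5:
  "multiplicity 2 (5 ^ i :: nat) = 0" "multiplicity 3 (5 ^ i :: nat) = 0"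
  "multiplicity 5 (5 ^ i :: nat) = i" "multiplicity 7 (5 ^ i :: nat) = 0"
  using multiplicity_monomial[of 0 0 i 0] by simp_all

lemma multiplicity_23:
  "multiplicity 2 (2 :: nat) = 1" "multiplicity 2 (3 :: nat) = 0"
  "multiplicity 3 (2 :: nat) = 0" "multiplicity 3 (3 :: nat) = 1"
  "multiplicity 5 (2 :: nat) = 0" "multiplicity 5 (3 :: nat) = 0"
  "multiplicity 7 (2 :: nat) = 0" "multiplicity 7 (3 :: nat) = 0"
  using multiplicity_monomial[of 1 0 0 0] multiplicity_monomial[of 0 1 0 0] by simp_all

text \<open>The exponent of 7 separates markers from all other letters.\<close>

lemma marker_neq: "marker M i \<noteq> 2" "marker M i \<noteq> 3" "marker M i \<noteq> 5 ^ j" "5 ^ j \<noteq> marker M i"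
proof -
  have neq: "marker M i \<noteq> x" if "multiplicity 7 x = 0" for x
    using that multiplicity_marker(4)[of M i] by auto
  show "marker M i \<noteq> 2" "marker M i \<noteq> 3" "marker M i \<noteq> 5 ^ j"
    by (intro neq multiplicity_23 multiplicity_power5)+
  then show "5 ^ j \<noteq> marker M i"
    by metis
qed

lemma power5_neq:
  assumes "0 < i"
  shows "(5::nat) ^ i \<noteq> 2" "(5::nat) ^ i \<noteq> 3"
proof -
  have "(5::nat) ^ i \<noteq> x" if "multiplicity 5 x = 0" for x
    using that multiplicity_power5(3)[of i] assms by auto
  then show "(5::nat) ^ i \<noteq> 2" "(5::nat) ^ i \<noteq> 3"
    using multiplicity_23(5,6) by blast+
qed

lemma zero_notin_factors: "0 \<notin> factors M"
  by (auto simp: factors_def marker_def)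

lemma finite_factors: "finite (factors M)"
  by (simp add: factors_def indices_def)

lemma factors_ge_2:
  assumes "k \<in> factors M"
  shows "2 \<le> k"
proof -
  have m: "2 \<le> marker M i" for i
  proof -
    have "0 < (2 ^ exp2 M i * 3 ^ exp3 M i * 5 ^ exp5 M i :: nat)"
      by simp
    then show ?thesis
      unfolding marker_def by linarith
  qed
  have p: "2 \<le> (5::nat) ^ i" if "M < i" for i
    using that self_le_power[of "5::nat" i] by linarith
  have "k = 2 \<or> k = 3 \<or> (\<exists>i. M < i \<and> k = 5 ^ i) \<or> (\<exists>i. k = marker M i)"
    using assms unfolding factors_def by auto
  then show ?thesis
    using m p by (elim disjE exE conjE) simp_all
qed

section \<open>The multisets of letters with the target as product\<close>

lemma set_letters:
  assumes "i \<in> indices M"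
  shows "set_mset (letters M n i) \<subseteq> factors M"
proof -
  have "set_mset (letters M n i) \<subseteq> {2, 3} \<union> set_mset (special M i)"
    by (auto simp: letters_def)
  moreover have "marker M i \<in> factors M"
    using assms unfolding factors_def by blast
  moreover have "5 ^ i \<in> factors M" if "\<not> i \<le> 1"
    using assms that by (auto simp: factors_def indices_def)
  ultimately show ?thesis
    by (auto simp: special_def factors_def split: if_splits)
qed

lemma prod_letters:
  assumes "i \<in> indices M" "exp2 M i \<le> n + 1" "exp3 M i \<le> n"
  shows "prod_mset (letters M n i) = target M n"
proof -
  have special: "prod_mset (special M i) = 2 ^ exp2 M i * 3 ^ exp3 M i * 5 ^ (2 * M) * 7"
    using assms(1)
    by (auto simp: special_def marker_def indices_def exp5_def simp flip: power_add)
  \<comment> \<open>The two inequalities assumed keep the subtractions in the exponents from being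
    truncated.\<close>
  have "2 ^ (n + 1 - exp2 M i) * 2 ^ exp2 M i = (2::nat) ^ (n + 1)"
    "3 ^ (n - exp3 M i) * 3 ^ exp3 M i = (3::nat) ^ n"
    using assms by (simp_all flip: power_add)
  then have "target M n = 2 ^ (n + 1 - exp2 M i) * 2 ^ exp2 M i *
      (3 ^ (n - exp3 M i) * 3 ^ exp3 M i) * 5 ^ (2 * M) * 7"
    by (simp only: target_def)
  then show ?thesis
    by (simp add: letters_def special mult_ac)
qed

lemma size_1_mset: "size A = 1 \<Longrightarrow> \<exists>x. A = {#x#}"
  by (rule size_eq_Suc_imp_eq_union[of A 0, THEN exE]) auto

text \<open>Exponents are compared prime by prime: 7 leaves a single marker, 5 decides whether a
  power of 5 accompanies it and which one, and 2 and 3 then count the ordinary letters.\<close>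

lemma factorization_multisets_subset:
  assumes A: "set_mset A \<subseteq> factors M" and prod: "prod_mset A = target M n"
  shows "\<exists>i\<in>indices M. exp2 M i \<le> n + 1 \<and> exp3 M i \<le> n \<and> A = letters M n i"
proof -
  \<comment> \<open>\<open>Q\<close> collects the markers and \<open>P\<close> the pure powers of 5;
    what remains of \<open>A\<close> are letters 2 and 3.\<close>
  define Q where "Q = filter_mset (\<lambda>x. 7 dvd x) A"
  define P where "P = filter_mset (\<lambda>x. \<not> 7 dvd x \<and> 5 dvd x) A"
  have decomp: "A = replicate_mset (count A 2) 2 + replicate_mset (count A 3) 3 + P + Q"
  proof (rule multiset_eqI)
    fix x
    show "count A x =
      count (replicate_mset (count A 2) 2 + replicate_mset (count A 3) 3 + P + Q) x"
    proof (cases "x \<in># A")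
      case True
      then have "x \<in> factors M"
        using A by blast
      then show ?thesis
        by (auto simp: P_def Q_def factors_def marker_def indices_def)
    qed (auto simp: P_def Q_def not_in_iff)
  qed
  have mult: "multiplicity p (target M n) =
      count A 2 * multiplicity p 2 + count A 3 * multiplicity p 3 +
      sum_mset (image_mset (multiplicity p) P) + sum_mset (image_mset (multiplicity p) Q)"
    if "prime p" for p :: nat
  proof -
    have "0 \<notin># A"
      using A zero_notin_factors by blast
    then have "multiplicity p (prod_mset A) = sum_mset (image_mset (multiplicity p) A)"
      using that by (simp add: prime_elem_multiplicity_prod_mset_distrib)
    also have "\<dots> = sum_mset (image_mset (multiplicity p)
        (replicate_mset (count A 2) 2 + replicate_mset (count A 3) 3 + P + Q))"
      by (subst decomp) simp
    finally show ?thesis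
      by (simp add: prod)
  qed
  have Q: "x \<in> marker M ` indices M" if "x \<in># Q" for x
  proof -
    have "x \<in> factors M" "7 dvd x"
      using that A by (auto simp: Q_def)
    moreover have "\<not> 7 dvd (5::nat) ^ j" for j
      using prime_dvd_power[of 7 "5::nat" j] by auto
    ultimately show ?thesis
      by (auto simp: factors_def)
  qed
  have P: "x \<in> (\<lambda>i. 5 ^ i) ` {M<..2 * M}" if "x \<in># P" for x
    using that A by (auto simp: P_def factors_def marker_def)
  \<comment> \<open>Each marker carries one factor 7, the other letters carry none, and the target
    has one.\<close>
  have "image_mset (multiplicity 7) Q = image_mset (\<lambda>_. 1) Q"
    by (intro image_mset_cong) (auto dest!: Q simp: multiplicity_marker)
  moreover have "image_mset (multiplicity 7) P = image_mset (\<lambda>_. 0) P"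
    by (intro image_mset_cong) (auto dest!: P simp: multiplicity_power5)
  ultimately have "size Q = 1"
    using mult[of 7] by (simp add: multiplicity_target multiplicity_23)
  then obtain x where "Q = {#x#}"
    using size_1_mset by blast
  then obtain i where i: "i \<in> indices M" "Q = {#marker M i#}"
    using Q[of x] by auto
  have m5: "sum_mset (image_mset (multiplicity 5) P) + exp5 M i = 2 * M"
    using mult[of 5] i by (simp add: multiplicity_target multiplicity_23 multiplicity_marker)
  \<comment> \<open>Each member of \<open>P\<close> has exponent at least \<open>M + 1\<close>, and
    two such exponents exceed \<open>2 * M\<close>.\<close>
  have "sum_mset (image_mset (\<lambda>_. Suc M) P) \<le> sum_mset (image_mset (multiplicity 5) P)"
    by (intro sum_mset_mono) (auto dest!: P simp: multiplicity_power5)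
  then have "size P * Suc M \<le> 2 * M"
    using m5 by simp
  then have "\<not> 2 \<le> size P"
    using mult_le_mono1[of 2 "size P" "Suc M"] by auto
  then have "size P = 0 \<or> size P = 1"
    by linarith
  then have "P + Q = special M i"
  proof -
    consider "P = {#}" | x where "P = {#x#}"
      using \<open>size P = 0 \<or> size P = 1\<close> size_1_mset size_eq_0_iff_empty by metis
    then consider "P = {#}" | j where "P = {#5 ^ j#}" "M < j" "j \<le> 2 * M"
    proof cases
      case 2
      then show thesis
        using P[of x] that(2) by auto
    qed
    then show ?thesis
    proof cases
      \<comment> \<open>Without a power of 5 the marker supplies the whole exponent
        \<open>2 * M\<close>, as only indices 0 and 1 do.\<close>
      case 1
      then show ?thesis
        using m5 i by (auto simp: special_def exp5_def indices_def split: if_splits)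
    next
      case 2
      \<comment> \<open>The marker supplies less than \<open>2 * M\<close>, so \<open>i > 1\<close>;
        its exponent \<open>2 * M - i\<close> then forces \<open>i = j\<close>.\<close>
      then have "j + exp5 M i = 2 * M"
        using m5 by (simp add: multiplicity_power5)
      then have "\<not> i \<le> 1" "i = j"
        using 2 i by (auto simp: exp5_def indices_def split: if_splits)
      then show ?thesis
        using 2 i by (simp add: special_def)
    qed
  qed
  moreover have "count A 2 + exp2 M i = n + 1" "count A 3 + exp3 M i = n"
  proof -
    have "image_mset (multiplicity p) P = image_mset (\<lambda>_. 0) P" if "p = 2 \<or> p = 3" for p
      using that by (intro image_mset_cong) (auto dest!: P simp: multiplicity_power5)
    then show "count A 2 + exp2 M i = n + 1" "count A 3 + exp3 M i = n"
      using mult[of 2] mult[of 3] i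
      by (simp_all add: multiplicity_target multiplicity_23 multiplicity_marker)
  qed
  then have "n + 1 - exp2 M i = count A 2" "n - exp3 M i = count A 3"
    "exp2 M i \<le> n + 1" "exp3 M i \<le> n"
    by linarith+
  ultimately show ?thesis
    using i(1) decomp by (auto simp: letters_def add.assoc)
qed

lemma factorization_multisets:
  "{A. set_mset A \<subseteq> factors M \<and> prod_mset A = target M n} =
     letters M n ` {i \<in> indices M. exp2 M i \<le> n + 1 \<and> exp3 M i \<le> n}"
proof (intro equalityI subsetI)
  fix A assume "A \<in> {A. set_mset A \<subseteq> factors M \<and> prod_mset A = target M n}"
  then show "A \<in> letters M n ` {i \<in> indices M. exp2 M i \<le> n + 1 \<and> exp3 M i \<le> n}"
    using factorization_multisets_subset[of A M n] by blast
qed (use set_letters prod_letters in auto)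

text \<open>Deleting the letters 2 and 3 leaves the special letters, which determine the index: a
  pair through its power of 5, a lone marker through its exponent of 2.\<close>

lemma inj_letters: "inj_on (letters M n) (indices M)"
proof (rule inj_onI)
  fix i j assume ij: "i \<in> indices M" "j \<in> indices M" "letters M n i = letters M n j"
  have filter: "filter_mset (\<lambda>x. x \<noteq> 2 \<and> x \<noteq> 3) (letters M n k) = special M k"
    if "k \<in> indices M" for k
    using that marker_neq power5_neq
    by (auto simp: letters_def special_def indices_def)
  then have eq: "special M i = special M j"
    using ij by metis
  show "i = j"
  proof (cases "i \<le> 1 \<or> j \<le> 1")
    case True
    then have "i \<le> 1" "j \<le> 1" "marker M i = marker M j"
      using eq by (auto simp: special_def split: if_splits)
    then have "exp2 M i = exp2 M j"
      by (metis multiplicity_marker(1))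
    moreover have "i = 0 \<or> i = 1" "j = 0 \<or> j = 1"
      using \<open>i \<le> 1\<close> \<open>j \<le> 1\<close> by linarith+
    ultimately show ?thesis
      by (auto simp: exp2_def)
  next
    case False
    then have "{#5 ^ i, marker M i#} = {#5 ^ j, marker M j#}"
      using eq by (simp add: special_def)
    then have "5 ^ i \<in># {#5 ^ j, marker M j#}"
      by (metis union_single_eq_member)
    then show ?thesis
      using marker_neq(4) by auto
  qed
qed

lemma card_factorizations_factors:
  "card (factorizations (factors M) (target M n)) =
     (\<Sum>i | i \<in> indices M \<and> exp2 M i \<le> n + 1 \<and> exp3 M i \<le> n.
        card (permutations_of_multiset (letters M n i)))"
proof -
  let ?J = "{i \<in> indices M. exp2 M i \<le> n + 1 \<and> exp3 M i \<le> n}"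
  have "inj_on (letters M n) ?J"
    by (rule inj_on_subset[OF inj_letters]) auto
  moreover have "finite ?J"
    by (simp add: indices_def)
  ultimately show ?thesis
    using card_factorizations[of "factors M" "target M n"]
    by (simp add: factorization_multisets sum.reindex)
qed

section \<open>Counting words: each count as a multiple of the Catalan number\<close>

lemma fact_catalan: "fact (2 * n) = (n + 1) * catalan n * (fact n * fact n)"
  unfolding catalan_exact using binomial_fact_lemma[of n "2 * n"] by (simp add: ac_simps)

text \<open>This is \<open>x_0\<close>, with \<open>(2n)!\<close> expressed through the Catalan
  number.\<close>

lemma card_letters_0:
  "card (permutations_of_multiset (letters M n 0)) = (n + 1) * (2 * n + 1) * catalan n"
proof -
  have "card (permutations_of_multiset (letters M n 0)) * (fact n * fact n) = fact (n + n + 1)"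
    using card_permutations_one_extra[of 2 3 "marker M 0" n n] marker_neq[of M 0]
    by (simp add: letters_def special_def exp2_def exp3_def)
  also have "\<dots> = (2 * n + 1) * fact (2 * n)"
    by (simp flip: mult_2)
  also have "\<dots> = (n + 1) * (2 * n + 1) * catalan n * (fact n * fact n)"
    unfolding fact_catalan by (simp only: mult_ac)
  finally show ?thesis
    by simp
qed

text \<open>This is \<open>x_1\<close>; the factor \<open>n\<close> comes from
  \<open>n! = n * (n - 1)!\<close>.\<close>

lemma card_letters_1:
  assumes "1 \<le> n"
  shows "card (permutations_of_multiset (letters M n 1)) = n * (2 * n + 1) * catalan n"
proof -
  obtain k where n: "n = Suc k"
    using assms by (cases n) auto
  let ?c = "card (permutations_of_multiset (letters M n 1))"
  have "?c * (fact (n + 1) * fact k) = fact (n + 1 + k + 1)"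
    using card_permutations_one_extra[of 2 3 "marker M 1" "n + 1" k] marker_neq[of M 1]
    by (simp add: letters_def special_def exp2_def exp3_def n)
  also have "\<dots> = (2 * n + 1) * fact (2 * n)"
    by (simp add: n flip: mult_2)
  also have "\<dots> = n * (2 * n + 1) * catalan n * (fact (n + 1) * fact k)"
    unfolding fact_catalan by (simp add: n algebra_simps)
  finally show ?thesis
    by simp
qed

text \<open>This is \<open>g_0\<close>: the pair of special letters uses up two factors 2 and one
  factor 3.\<close>

lemma card_letters_low:
  assumes "1 < i" "i + 4 \<le> 2 * M" "1 \<le> n"
  shows "card (permutations_of_multiset (letters M n i)) = n ^ 2 * (n + 1) * catalan n"
proof -
  obtain k where n: "n = Suc k"
    using assms by (cases n) auto
  have distinct: "distinct [2, 3, 5 ^ i, marker M i]"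
    using assms(1) power5_neq[of i] marker_neq(1,2)[of M i] marker_neq(4)[of i M i] by auto
  let ?c = "card (permutations_of_multiset (letters M n i))"
  have "?c * (fact k * fact k) = fact (k + k + 2)"
    using card_permutations_two_extra[OF distinct, of k k] assms
    by (simp add: letters_def special_def exp2_def exp3_def n del: fact_Suc)
  also have "\<dots> = fact (2 * n)"
    by (simp add: n flip: mult_2)
  also have "\<dots> = n ^ 2 * (n + 1) * catalan n * (fact k * fact k)"
    unfolding fact_catalan by (simp add: n algebra_simps power2_eq_square)
  finally show ?thesis
    by simp
qed

text \<open>This is \<open>g_1\<close>: the pair of special letters uses up one factor 2 and two
  factors 3.\<close>

lemma card_letters_high:
  assumes "1 < i" "\<not> i + 4 \<le> 2 * M" "2 \<le> n"
  shows "card (permutations_of_multiset (letters M n i)) = (n - 1) * n * (n + 1) * catalan n"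
proof -
  obtain k where n: "n = Suc (Suc k)"
    using assms by (metis add_2_eq_Suc le_Suc_ex)
  then have k: "n - 2 = k"
    by simp
  have distinct: "distinct [2, 3, 5 ^ i, marker M i]"
    using assms(1) power5_neq[of i] marker_neq(1,2)[of M i] marker_neq(4)[of i M i] by auto
  let ?c = "card (permutations_of_multiset (letters M n i))"
  have "?c * (fact n * fact k) = fact (n + k + 2)"
    using card_permutations_two_extra[OF distinct, of n k] assms
    by (simp add: letters_def special_def exp2_def exp3_def k del: fact_Suc)
  also have "n + k + 2 = 2 * n"
    by (simp add: n)
  also have "fact (2 * n) = (n - 1) * n * (n + 1) * catalan n * (fact n * fact k)"
    unfolding fact_catalan by (simp add: n algebra_simps)
  finally show ?thesis
    by simp
qed

text \<open>The total is \<open>x_0 + x_1 + (M - 4) * g_0 + 4 * g_1\<close>. By the identity for the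
  Catalan number this equals that number plus \<open>M * g_0\<close>.\<close>

lemma count_factorizations:
  assumes "4 \<le> M"
  shows "card (factorizations (factors M) (target M n)) =
    catalan n + M * (n ^ 2 * (n + 1) * catalan n)"
proof -
  let ?low = "n ^ 2 * (n + 1) * catalan n" and ?high = "(n - 1) * n * (n + 1) * catalan n"
  let ?ok = "\<lambda>i. exp2 M i \<le> n + 1 \<and> exp3 M i \<le> n"
  \<comment> \<open>For small \<open>n\<close> some special letters contain more factors 2 or 3 than
    the target and contribute nothing. The closed formulas vanish in exactly those cases, so they
    hold for every \<open>n\<close>.\<close>
  let ?c = "\<lambda>i. if ?ok i then card (permutations_of_multiset (letters M n i)) else 0"
  have c0: "?c 0 = (n + 1) * (2 * n + 1) * catalan n"
    by (simp add: card_letters_0 exp2_def exp3_def)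
  have c1: "?c 1 = n * (2 * n + 1) * catalan n"
    using card_letters_1[of n M] by (auto simp: exp2_def exp3_def)
  have low: "?c i = ?low" if "i \<in> {M<..2 * M - 4}" for i
  proof -
    have i: "1 < i" "i + 4 \<le> 2 * M"
      using that assms by auto
    then show ?thesis
      using card_letters_low[OF i, of n] by (auto simp: exp2_def exp3_def)
  qed
  have high: "?c i = ?high" if "i \<in> {2 * M - 4<..2 * M}" for i
  proof -
    have i: "1 < i" "\<not> i + 4 \<le> 2 * M"
      using that assms by auto
    show ?thesis
    proof (cases "2 \<le> n")
      case True
      then show ?thesis
        using i card_letters_high[OF i, of n] by (auto simp: exp2_def exp3_def)
    next
      case False
      then have "n = 0 \<or> n = 1"
        by linarith
      then show ?thesis
        using i by (auto simp: exp2_def exp3_def)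
    qed
  qed
  \<comment> \<open>The lower range has \<open>M - 4\<close> indices and the upper one 4;
    \<open>4 \<le> M\<close> ensures that the cut is not below \<open>M\<close>.\<close>
  have split: "{M<..2 * M} = {M<..2 * M - 4} \<union> {2 * M - 4<..2 * M}"
    using assms by auto
  have "card (factorizations (factors M) (target M n)) = (\<Sum>i\<in>indices M. ?c i)"
    unfolding card_factorizations_factors
    by (subst sum.inter_filter[symmetric]) (auto simp: indices_def)
  also have "\<dots> = ?c 0 + ?c 1 + (\<Sum>i\<in>{M<..2 * M}. ?c i)"
    using assms unfolding indices_def by (subst sum.union_disjoint) (auto simp del: One_nat_def)
  also have "(\<Sum>i\<in>{M<..2 * M}. ?c i) =
      (\<Sum>i\<in>{M<..2 * M - 4}. ?c i) + (\<Sum>i\<in>{2 * M - 4<..2 * M}. ?c i)"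
    unfolding split by (intro sum.union_disjoint) auto
  also have "(\<Sum>i\<in>{M<..2 * M - 4}. ?c i) = (\<Sum>i\<in>{M<..2 * M - 4}. ?low)"
    by (intro sum.cong refl low)
  also have "\<dots> = (M - 4) * ?low"
    by simp
  also have "(\<Sum>i\<in>{2 * M - 4<..2 * M}. ?c i) = (\<Sum>i\<in>{2 * M - 4<..2 * M}. ?high)"
    by (intro sum.cong refl high)
  also have "\<dots> = 4 * ?high"
    using assms by simp
  finally have total: "card (factorizations (factors M) (target M n)) =
      ?c 0 + ?c 1 + ((M - 4) * ?low + 4 * ?high)" .
  \<comment> \<open>After dividing by the Catalan number:
    \<open>(2n+1)^2 + 4(n-1)n(n+1) = 1 + 4n^2(n+1)\<close>. The case \<open>n = 0\<close> is
    separate because of the truncated \<open>n - 1\<close>.\<close>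
  have "(n + 1) * (2 * n + 1) * catalan n + n * (2 * n + 1) * catalan n + 4 * ?high =
      catalan n + 4 * ?low"
    by (cases n) (simp_all add: algebra_simps power2_eq_square)
  moreover have "M * ?low = (M - 4) * ?low + 4 * ?low"
    using assms by (metis add_mult_distrib le_add_diff_inverse2)
  ultimately show ?thesis
    unfolding total c0 c1 by linarith
qed

section \<open>Lengths in base 6 and the congruence\<close>

lemma target_eq: "target M n = 6 ^ n * target M 0"
proof -
  have "(6::nat) ^ n = 2 ^ n * 3 ^ n"
    by (simp flip: power_mult_distrib)
  then show ?thesis
    by (simp add: target_def)
qed

theorem proposition4p8:
  fixes m :: nat
  assumes "m \<ge> 1"
  shows "\<exists>f \<in> tile_counting_functions. \<forall>n. [f n = catalan n] (mod m)"
proof -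
  \<comment> \<open>A multiple of \<open>m\<close>, so that the surplus \<open>M * g_0\<close>
    vanishes modulo \<open>m\<close>, and at least 4, to leave room for the four pairs counted by
    \<open>g_1\<close>.\<close>
  define M where "M = 4 * m"
  have "4 \<le> M"
    using assms by (simp add: M_def)
  define T where "T = rectangle ` (\<lambda>k. log 6 (real k)) ` factors M"
  \<comment> \<open>With this offset the length \<open>n + \<epsilon>\<close> is the base 6
    logarithm of \<open>target M n\<close>, since each unit of length contributes a factor
    6.\<close>
  define \<epsilon> where "\<epsilon> = log 6 (real (target M 0))"
  have target_ge_2: "2 \<le> target M n" for n
  proof -
    have "0 < (2 ^ (n + 1) * 3 ^ n * 5 ^ (2 * M) :: nat)"
      by simp
    then show ?thesis
      unfolding target_def by linarith
  qed
  have "tall_tile t" if t: "t \<in> T" for t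
  proof -
    obtain k where "k \<in> factors M" "t = rectangle (log 6 (real k))"
      using t unfolding T_def by blast
    then show ?thesis
      using factors_ge_2[of k M] by (auto intro!: tall_tile_rectangle)
  qed
  moreover have "finite T"
    by (simp add: T_def finite_factors)
  moreover have "0 \<le> \<epsilon>"
    using target_ge_2[of 0] by (simp add: \<epsilon>_def)
  ultimately have "tile_count T \<epsilon> \<in> tile_counting_functions"
    unfolding tile_counting_functions_def by blast
  moreover have "[tile_count T \<epsilon> n = catalan n] (mod m)" for n
  proof -
    have "real n + \<epsilon> = log 6 (real (target M n))"
      using target_ge_2[of 0] unfolding \<epsilon>_def target_eq[of M n]
      by (simp add: log_mult log_nat_power)
    then have "tile_count T \<epsilon> n = card (factorizations (factors M) (target M n))"
      using card_tilings_log[of "factors M" 6 "target M n"] finite_factors factors_ge_2 target_ge_2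
      by (simp add: tile_count_def T_def)
    also have "\<dots> = catalan n + m * (4 * (n ^ 2 * (n + 1) * catalan n))"
      using count_factorizations[OF \<open>4 \<le> M\<close>, of n] by (simp add: M_def ac_simps)
    finally show ?thesis
      by (simp add: cong_def)
  qed
  ultimately show ?thesis
    by blast
qed

end
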